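(* Let $n,N\in\mathbb{N}$, let $m_{k,\ell}\in\mathbb{N}\cup\{0\}$ for $k=1,\ldots,n$ and $\ell=0,\ldots,N-1$, and let $a_{k,j_0,\ldots,j_{N-1}}$ be analytic functions in the unit disc $\mathbb{D}$ for $k=1,\ldots,n$ and $0\le j_\ell\le m_{k,\ell}$ ($\ell=0,\ldots,N-1$). Suppose that $$\max_{k=1,\ldots,n}\frac{m_{k,0}}{k}\le2\quad\text{and}\quad\max_{k=1,\ldots,n}\frac{m_{k,\ell}}{k}\le1\quad\text{for all }\ell=1,\ldots,N-1.$$ Then there exists a constant $C>0$, depending only on $n$, $N$ and the numbers $m_{k,\ell}$, such that each meromorphic solution $f$ in $\mathbb{D}$ of $$\left(f^{(N)}\right)^n+\sum_{k=1}^{n}P_{k,N}(f)\left(f^{(N)}\right)^{n-k}=0,\qquad P_{k,N}(f)=\sum_{j_0=0}^{m_{k,0}}\sum_{j_1=0}^{m_{k,1}}\cdots\sum_{j_{N-1}=0}^{m_{k,N-1}}a_{k,j_0,\ldots,j_{N-1}}\prod_{\ell=0}^{N-1}\left(f^{(\ell)}\right)^{j_\ell},$$ satisfies, at every point of $\mathbb{D}$, $$\prod_{\ell=0}^{N-1}\left(f^{(\ell)}\right)^{\#}\le C\sum_{k=1}^n\left(\sum_{j_0=0}^{m_{k,0}}\sum_{j_1=0}^{m_{k,1}}\cdots\sum_{j_{N-1}=0}^{m_{k,N-1}}|a_{k,j_0,\ldots,j_{N-1}}|^{\frac1k}\right).$$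
   Context: $\mathbb{D}=\{z\in\mathbb{C}:|z|<1\}$ and $\mathbb{N}=\{1,2,\ldots\}$. For a function $g$ meromorphic in $\mathbb{D}$, $g^{\#}=\frac{|g'|}{1+|g|^2}$ denotes the spherical derivative, extended continuously to the poles of $g$. $f^{(\ell)}$ is the $\ell$-th derivative, with $f^{(0)}=f$; zeroth powers are identically $1$. A meromorphic solution is a meromorphic function in $\mathbb{D}$ satisfying the equation as an identity of meromorphic functions. *)

theory Defs
  imports "HOL-Complex_Analysis.Complex_Analysis"
begin

text \<open>A function that is \<open>meromorphic_on\<close> a set carries arbitrary values at its poles (and, more
  generally, on a sparse set).  At every point where \<open>g\<close> is not analytic, the spherical derivative
  is therefore the continuous extension of the usual formula from a punctured neighbourhood.\<close>

definition spherical_deriv :: "(complex \<Rightarrow> complex) \<Rightarrow> complex \<Rightarrow> real" where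
  "spherical_deriv g z =
     (if g analytic_on {z} then norm (deriv g z) / (1 + (norm (g z))\<^sup>2)
      else Lim (at z) (\<lambda>w. norm (deriv g w) / (1 + (norm (g w))\<^sup>2)))"

text \<open>A multi-index \<open>(j\<^sub>0, \<dots>, j\<^bsub>N-1\<^esub>)\<close> is a function on \<open>{..<N}\<close>, extended by
  \<open>undefined\<close> so that there are only finitely many.\<close>

definition multi_indices :: "(nat \<Rightarrow> nat \<Rightarrow> nat) \<Rightarrow> nat \<Rightarrow> nat \<Rightarrow> (nat \<Rightarrow> nat) set" where
  "multi_indices m N k = (\<Pi>\<^sub>E l\<in>{..<N}. {0..m k l})"

definition diff_poly ::
  "(nat \<Rightarrow> nat \<Rightarrow> nat) \<Rightarrow> (nat \<Rightarrow> (nat \<Rightarrow> nat) \<Rightarrow> complex \<Rightarrow> complex) \<Rightarrow> nat \<Rightarrow> nat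
     \<Rightarrow> (complex \<Rightarrow> complex) \<Rightarrow> complex \<Rightarrow> complex" where
  "diff_poly m a k N f z =
     (\<Sum>j\<in>multi_indices m N k. a k j z * (\<Prod>l<N. ((deriv ^^ l) f z) ^ j l))"

text \<open>Identities between meromorphic functions are identities off a sparse subset of the domain.\<close>

definition meromorphic_solution ::
  "nat \<Rightarrow> nat \<Rightarrow> (nat \<Rightarrow> nat \<Rightarrow> nat) \<Rightarrow> (nat \<Rightarrow> (nat \<Rightarrow> nat) \<Rightarrow> complex \<Rightarrow> complex)
     \<Rightarrow> (complex \<Rightarrow> complex) \<Rightarrow> bool" where
  "meromorphic_solution n N m a f \<longleftrightarrow>
     f meromorphic_on ball 0 1 \<and>
     (\<forall>\<^sub>\<approx>z\<in>ball 0 1.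
        ((deriv ^^ N) f z) ^ n
          + (\<Sum>k=1..n. diff_poly m a k N f z * ((deriv ^^ N) f z) ^ (n - k)) = 0)"

end

theory Submission
  imports Defs
begin

text \<open>
  Where \<open>f\<close> is analytic and the equation holds, Fujiwara's bound for the roots of a monic polynomial
  gives \<open>\<bar>f\<^sup>(\<^sup>N\<^sup>)\<bar> \<le> 2 \<Sum>\<^sub>k \<bar>P\<^sub>k\<bar>\<^sup>1\<^sup>/\<^sup>k\<close>.  The product of the spherical derivatives telescopes to
  \<open>\<bar>f\<^sup>(\<^sup>N\<^sup>)\<bar>\<close> times one factor \<open>\<bar>f\<^sup>(\<^sup>l\<^sup>)\<bar>\<^sup>e / (1 + \<bar>f\<^sup>(\<^sup>l\<^sup>)\<bar>\<^sup>2)\<close> for each \<open>l < N\<close>, with \<open>e = 0\<close> for \<open>l = 0\<close> and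
  \<open>e = 1\<close> otherwise.  The degree conditions say exactly that such a factor still absorbs the
  power \<open>\<bar>f\<^sup>(\<^sup>l\<^sup>)\<bar>\<^sup>j\<^sup>/\<^sup>k\<close> coming from \<open>\<bar>P\<^sub>k\<bar>\<^sup>1\<^sup>/\<^sup>k\<close>, so \<open>C = 2\<close> works.  The remaining points are isolated, and
  both sides of the inequality extend continuously to them.
\<close>

section \<open>Inequalities for power sums, polynomial roots and real powers\<close>

lemma sum_power_le_power_sum:
  fixes x :: "'a \<Rightarrow> real"
  assumes "finite A" "\<And>i. i \<in> A \<Longrightarrow> x i \<ge> 0" "k \<ge> 1"
  shows "(\<Sum>i\<in>A. x i ^ k) \<le> (\<Sum>i\<in>A. x i) ^ k"
proof -
  let ?s = "\<Sum>i\<in>A. x i"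
  have k: "u ^ k = u * u ^ (k - 1)" for u :: real
    using assms(3) by (cases k) auto
  have "(\<Sum>i\<in>A. x i ^ k) = (\<Sum>i\<in>A. x i * x i ^ (k - 1))"
    by (simp only: k)
  \<comment> \<open>One factor of each power is kept; the other \<open>k - 1\<close> are bounded by
    the full sum.\<close>
  also have "\<dots> \<le> (\<Sum>i\<in>A. x i * ?s ^ (k - 1))"
    using assms(1,2) by (intro sum_mono mult_left_mono power_mono member_le_sum) auto
  also have "\<dots> = ?s ^ k"
    by (simp only: k[of ?s] sum_distrib_right)
  finally show ?thesis .
qed

lemma sum_half_powers: "(\<Sum>k=1..n. (1/2 :: real) ^ k) = 1 - (1/2) ^ n"
  by (induction n) auto

text \<open>If \<open>norm w\<close> exceeded \<open>2 * s\<close>, the \<open>k\<close>-th lower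
  term would be at most \<open>norm w ^ n / 2 ^ k\<close>. The geometric sum of these falls short of
  \<open>norm w ^ n\<close>, so they could not cancel the leading term.\<close>

lemma norm_root_le:
  fixes w :: complex
  assumes root: "w ^ n + (\<Sum>k=1..n. p k * w ^ (n - k)) = 0"
    and p: "\<And>k. k \<in> {1..n} \<Longrightarrow> norm (p k) \<le> s ^ k" and "s \<ge> 0"
  shows "norm w \<le> 2 * s"
proof (rule ccontr)
  assume "\<not> ?thesis"
  hence s: "s \<le> norm w / 2" and w: "norm w > 0" using \<open>s \<ge> 0\<close> by auto
  have "norm w ^ n = norm (\<Sum>k=1..n. p k * w ^ (n - k))"
    using root by (metis add_eq_0_iff norm_minus_cancel norm_power)
  also have "\<dots> \<le> (\<Sum>k=1..n. norm w ^ n * (1/2) ^ k)"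
  proof (rule sum_norm_le)
    fix k assume k: "k \<in> {1..n}"
    have "norm (p k * w ^ (n - k)) \<le> (norm w / 2) ^ k * norm w ^ (n - k)"
      using p[OF k] power_mono[OF s \<open>s \<ge> 0\<close>, of k]
      by (auto simp: norm_mult norm_power intro!: mult_right_mono)
    also have "\<dots> = norm w ^ n * (1/2) ^ k"
      using k by (simp add: power_divide flip: power_add)
    finally show "norm (p k * w ^ (n - k)) \<le> norm w ^ n * (1/2) ^ k" .
  qed
  also have "\<dots> = norm w ^ n * (1 - (1/2) ^ n)"
    by (simp only: sum_half_powers flip: sum_distrib_left)
  finally have "norm w ^ n * (1/2) ^ n \<le> 0" by (simp add: algebra_simps)
  thus False using w by (simp add: mult_le_0_iff flip: not_less)
qed

text \<open>The total exponent \<open>j / k + e\<close> is at most 2. Replacing \<open>x\<close> by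
  \<open>max 1 x\<close> makes powers increase with the exponent, and the square of this maximum is
  still at most \<open>1 + x ^ 2\<close>.\<close>

lemma powr_root_mult_power_le:
  fixes x :: real
  assumes "x \<ge> 0" "k \<ge> 1" "j + e * k \<le> 2 * k" "e \<le> 2"
  shows "(x ^ j) powr (1 / real k) * x ^ e \<le> 1 + x\<^sup>2"
proof -
  define y where "y = max 1 x"
  have y: "y \<ge> 1" "x \<le> y" "y\<^sup>2 \<le> 1 + x\<^sup>2" by (auto simp: y_def max_def)
  have "j \<le> (2 - e) * k" using assms(3) by (simp add: diff_mult_distrib)
  have "x ^ j \<le> y ^ j" using assms y by (intro power_mono)
  also have "\<dots> \<le> y ^ ((2 - e) * k)" using y \<open>j \<le> _\<close> by (intro power_increasing)
  finally have "(x ^ j) powr (1 / real k) \<le> (y ^ ((2 - e) * k)) powr (1 / real k)"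
    using assms by (intro powr_mono2) auto
  also have "\<dots> = ((y ^ (2 - e)) powr real k) powr (1 / real k)"
    using y by (subst powr_realpow) (auto simp: power_mult)
  also have "\<dots> = y ^ (2 - e)"
    using y assms(2) by (simp add: powr_powr)
  finally have "(x ^ j) powr (1 / real k) * x ^ e \<le> y ^ (2 - e) * y ^ e"
    using assms y by (intro mult_mono power_mono) auto
  also have "\<dots> = y\<^sup>2" using assms by (simp flip: power_add)
  finally show ?thesis using y by simp
qed

section \<open>The spherical derivative as a limit at singularities\<close>

lemma tendsto_spherical_quotient_removable:
  assumes "isolated_singularity_at g z" "g \<midarrow>z\<rightarrow> c"
  obtains L where "(\<lambda>w. norm (deriv g w) / (1 + (norm (g w))\<^sup>2)) \<midarrow>z\<rightarrow> L"
proof -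
  let ?q = "\<lambda>g w. norm (deriv g w) / (1 + (norm (g w))\<^sup>2)"
  let ?h = "remove_sings g"
  have h: "?h analytic_on {z}" using assms by (rule remove_sings_analytic_at)
  have "1 + (norm u)\<^sup>2 \<noteq> 0" for u :: complex
    by (metis add_cancel_left_right add_nonneg_eq_0_iff zero_le_one zero_le_power2 zero_neq_one)
  hence "?q ?h \<midarrow>z\<rightarrow> ?q ?h z"
    using analytic_at_imp_isCont[OF h] analytic_at_imp_isCont[OF analytic_deriv[OF h]]
    unfolding isCont_def by (intro tendsto_intros) auto
  moreover have "eventually (\<lambda>w. ?q ?h w = ?q g w) (at z)"
    using isolated_singularity_at_altdef[THEN iffD1, OF assms(1)]
  proof eventually_elim
    case (elim w)
    \<comment> \<open>Agreement on a whole neighbourhood of \<open>w\<close>, not only at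
      \<open>w\<close>, so that the derivatives agree too.\<close>
    have ev: "eventually (\<lambda>u. ?h u = g u) (nhds w)"
      using elim by (rule eventually_remove_sings_eq_nhds)
    show ?case using deriv_cong_ev[OF ev refl] elim by simp
  qed
  ultimately show thesis using that by (blast intro: Lim_transform_eventually)
qed

text \<open>Since essential singularities are excluded, \<open>g\<close> or its inverse has a finite
  limit at \<open>z\<close>, which leads back to the removable case.\<close>

lemma tendsto_spherical_quotient:
  assumes "g meromorphic_on {z}"
  obtains L where "(\<lambda>w. norm (deriv g w) / (1 + (norm (g w))\<^sup>2)) \<midarrow>z\<rightarrow> L"
proof -
  have iso: "isolated_singularity_at g z" and "not_essential g z"
    using assms by (auto simp: meromorphic_at_iff)
  then consider c where "g \<midarrow>z\<rightarrow> c" | "is_pole g z" by (auto simp: not_essential_def)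
  thus thesis
  proof cases
    case 1
    thus ?thesis using tendsto_spherical_quotient_removable[OF iso] that by blast
  next
    case 2
    \<comment> \<open>The spherical derivative is invariant under inversion, which turns the pole into a zero.\<close>
    let ?h = "\<lambda>w. inverse (g w)"
    have "?h meromorphic_on {z}" using assms by (intro meromorphic_intros)
    hence iso_h: "isolated_singularity_at ?h z" by (simp add: meromorphic_at_iff)
    have h0: "?h \<midarrow>z\<rightarrow> 0"
      using 2 unfolding is_pole_def by (rule filterlim_compose[OF tendsto_inverse_0])
    from tendsto_spherical_quotient_removable[OF iso_h h0] obtain L
      where L: "(\<lambda>w. norm (deriv ?h w) / (1 + (norm (?h w))\<^sup>2)) \<midarrow>z\<rightarrow> L" .
    have "eventually (\<lambda>w. g w \<noteq> 0) (at z)"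
      using 2 by (rule non_zero_neighbour_pole)
    with isolated_singularity_at_altdef[THEN iffD1, OF iso]
    have "eventually (\<lambda>w. norm (deriv ?h w) / (1 + (norm (?h w))\<^sup>2)
                        = norm (deriv g w) / (1 + (norm (g w))\<^sup>2)) (at z)"
    proof eventually_elim
      case (elim w)
      have "(g has_field_derivative deriv g w) (at w)"
        using elim(1) by (rule analytic_derivI)
      from DERIV_inverse_fun[OF this elim(2)]
      have d: "deriv ?h w = - (inverse (g w) * deriv g w * inverse (g w))"
        by (intro DERIV_imp_deriv) (simp add: mult_ac)
      define r where "r = norm (g w)"
      have r: "r > 0" using elim(2) by (simp add: r_def)
      have "norm (deriv ?h w) / (1 + (norm (?h w))\<^sup>2)
              = norm (deriv g w) / r\<^sup>2 / (1 + 1 / r\<^sup>2)"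
        unfolding d by (simp add: r_def norm_mult norm_inverse divide_inverse power2_eq_square)
      also have "1 + 1 / r\<^sup>2 = (1 + r\<^sup>2) / r\<^sup>2"
        using r by (simp add: add_divide_distrib)
      finally show ?case using r by (simp add: r_def)
    qed
    with L show ?thesis using that by (blast intro: Lim_transform_eventually)
  qed
qed

text \<open>Unites both branches of \<open>spherical_deriv\<close> in one limit: continuity settles
  the analytic case, and existence of the limit gives \<open>Lim\<close> its meaning in the
  other.\<close>

lemma tendsto_spherical_deriv:
  assumes "g meromorphic_on {z}"
  shows "(\<lambda>w. norm (deriv g w) / (1 + (norm (g w))\<^sup>2)) \<midarrow>z\<rightarrow> spherical_deriv g z"
proof (cases "g analytic_on {z}")
  case True
  have "1 + (norm u)\<^sup>2 \<noteq> 0" for u :: complex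
    by (metis add_cancel_left_right add_nonneg_eq_0_iff zero_le_one zero_le_power2 zero_neq_one)
  thus ?thesis using True
      analytic_at_imp_isCont[OF True] analytic_at_imp_isCont[OF analytic_deriv[OF True]]
    unfolding isCont_def spherical_deriv_def by (auto intro!: tendsto_intros)
next
  case False
  obtain L where "(\<lambda>w. norm (deriv g w) / (1 + (norm (g w))\<^sup>2)) \<midarrow>z\<rightarrow> L"
    using assms by (rule tendsto_spherical_quotient)
  thus ?thesis using False by (simp add: spherical_deriv_def tendsto_Lim)
qed

section \<open>The estimate at a single point where the equation holds\<close>

lemma meromorphic_on_higher_deriv:
  "f meromorphic_on A \<Longrightarrow> (deriv ^^ l) f meromorphic_on A"
  by (induction l) (auto intro: meromorphic_on_deriv)

lemma finite_multi_indices: "finite (multi_indices m N k)"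
  unfolding multi_indices_def by (intro finite_PiE) auto

text \<open>Here \<open>x l\<close> stands for \<open>f\<^sup>(\<^sup>l\<^sup>)\<close> and \<open>b k j\<close> for the coefficients, at a fixed point.\<close>

lemma algebraic_estimate:
  fixes x :: "nat \<Rightarrow> complex" and b :: "nat \<Rightarrow> (nat \<Rightarrow> nat) \<Rightarrow> complex"
  assumes "N \<ge> 1"
    and m0: "\<And>k. k \<in> {1..n} \<Longrightarrow> m k 0 \<le> 2 * k"
    and m1: "\<And>k l. k \<in> {1..n} \<Longrightarrow> l \<in> {1..<N} \<Longrightarrow> m k l \<le> k"
    and eq: "x N ^ n + (\<Sum>k=1..n. (\<Sum>j\<in>multi_indices m N k. b k j * (\<Prod>l<N. x l ^ j l))
                            * x N ^ (n - k)) = 0"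
  shows "(\<Prod>l<N. norm (x (Suc l)) / (1 + (norm (x l))\<^sup>2))
           \<le> 2 * (\<Sum>k=1..n. \<Sum>j\<in>multi_indices m N k. norm (b k j) powr (1 / real k))"
proof -
  \<comment> \<open>\<open>t k j\<close> is the \<open>k\<close>-th root of the modulus of one
    monomial. The root bound is applied with the sum \<open>s\<close> of all these roots, so that
    every monomial can be estimated separately.\<close>
  define t where "t k j = norm (b k j * (\<Prod>l<N. x l ^ j l)) powr (1 / real k)" for k j
  define s where "s = (\<Sum>k=1..n. \<Sum>j\<in>multi_indices m N k. t k j)"
  define D where "D = (\<Prod>l<N. 1 + (norm (x l))\<^sup>2)"
  \<comment> \<open>The numerators are the norms of \<open>x 1\<close>, ..., \<open>x N\<close>.
    With \<open>x N\<close> split off, \<open>x 0\<close> does not occur and each other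
    \<open>x l\<close> with \<open>l < N\<close> occurs once.\<close>
  define e where "e l = (if l = 0 then 0 else 1 :: nat)" for l :: nat
  define E where "E = (\<Prod>l<N. norm (x l) ^ e l)"
  have t0: "t k j \<ge> 0" for k j by (simp add: t_def)
  have "norm (x N) \<le> 2 * s"
  proof (rule norm_root_le[OF eq])
    fix k assume k: "k \<in> {1..n}"
    have "norm (\<Sum>j\<in>multi_indices m N k. b k j * (\<Prod>l<N. x l ^ j l))
            \<le> (\<Sum>j\<in>multi_indices m N k. t k j ^ k)"
    proof (rule sum_norm_le)
      fix j
      have "t k j ^ k = norm (b k j * (\<Prod>l<N. x l ^ j l))"
      proof (cases "norm (b k j * (\<Prod>l<N. x l ^ j l)) = 0")
        case True
        thus ?thesis using k unfolding t_def True by simp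
      next
        case False
        hence "norm (b k j * (\<Prod>l<N. x l ^ j l)) > 0" by (metis norm_ge_zero order_le_less)
        thus ?thesis using k unfolding t_def by (subst powr_power) auto
      qed
      thus "norm (b k j * (\<Prod>l<N. x l ^ j l)) \<le> t k j ^ k" by simp
    qed
    also have "\<dots> \<le> (\<Sum>j\<in>multi_indices m N k. t k j) ^ k"
      using k t0 by (intro sum_power_le_power_sum finite_multi_indices) auto
    also have "\<dots> \<le> s ^ k"
      unfolding s_def using k t0
      by (intro power_mono sum_nonneg
          member_le_sum[of k "{1..n}" "\<lambda>k. \<Sum>j\<in>multi_indices m N k. t k j"]) auto
    finally show "norm (\<Sum>j\<in>multi_indices m N k. b k j * (\<Prod>l<N. x l ^ j l)) \<le> s ^ k" .
  qed (auto simp: s_def intro!: sum_nonneg t0)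
  have "D > 0" unfolding D_def by (intro prod_pos) (auto intro: add_pos_nonneg)
  have "E \<ge> 0" unfolding E_def by (intro prod_nonneg) auto
  \<comment> \<open>Both sides split into factors indexed by \<open>l\<close>, and
    \<open>powr_root_mult_power_le\<close> compares them one by one; \<open>m0\<close> serves
    \<open>l = 0\<close> and \<open>m1\<close> the other indices.\<close>
  have term_le: "t k j * E \<le> norm (b k j) powr (1 / real k) * D"
    if k: "k \<in> {1..n}" and j: "j \<in> multi_indices m N k" for k j
  proof -
    have "t k j = norm (b k j) powr (1 / real k) * (\<Prod>l<N. (norm (x l) ^ j l) powr (1 / real k))"
      unfolding t_def by (simp add: norm_mult powr_mult prod_powr_distrib norm_power
          prod_nonneg flip: prod_norm)
    hence "t k j * E = norm (b k j) powr (1 / real k)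
        * (\<Prod>l<N. (norm (x l) ^ j l) powr (1 / real k) * norm (x l) ^ e l)"
      by (simp add: E_def prod.distrib)
    also have "\<dots> \<le> norm (b k j) powr (1 / real k) * D"
      unfolding D_def
    proof (intro mult_left_mono prod_mono conjI powr_root_mult_power_le)
      fix l assume l: "l \<in> {..<N}"
      hence "j l \<le> m k l" using j by (auto simp: multi_indices_def PiE_iff)
      thus "j l + e l * k \<le> 2 * k"
        using m0[OF k] m1[OF k, of l] l by (cases "l = 0") (auto simp: e_def)
    qed (use k in \<open>auto simp: e_def\<close>)
    finally show ?thesis .
  qed
  have "(\<Prod>l<N. norm (x (Suc l))) = norm (x N) * E"
  proof -
    obtain M where M: "N = Suc M" using \<open>N \<ge> 1\<close> by (cases N) auto
    have "E = (\<Prod>l<M. norm (x (Suc l)))"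
      unfolding E_def M by (subst prod.lessThan_Suc_shift) (simp add: e_def)
    thus ?thesis by (simp add: M)
  qed
  hence "(\<Prod>l<N. norm (x (Suc l)) / (1 + (norm (x l))\<^sup>2)) = norm (x N) * E / D"
    by (simp add: D_def prod_dividef)
  also have "\<dots> \<le> 2 * s * E / D"
    using \<open>norm (x N) \<le> 2 * s\<close> \<open>D > 0\<close> \<open>E \<ge> 0\<close> by (intro divide_right_mono mult_right_mono) auto
  also have "s * E \<le> (\<Sum>k=1..n. \<Sum>j\<in>multi_indices m N k. norm (b k j) powr (1 / real k)) * D"
    unfolding s_def sum_distrib_right by (intro sum_mono term_le)
  hence "2 * s * E / D \<le> 2 * (\<Sum>k=1..n. \<Sum>j\<in>multi_indices m N k. norm (b k j) powr (1 / real k))"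
    using \<open>D > 0\<close> by (simp add: field_simps)
  finally show ?thesis .
qed

theorem corollary2:
  fixes n N :: nat and m :: "nat \<Rightarrow> nat \<Rightarrow> nat"
  assumes "n \<ge> 1" and "N \<ge> 1"
    and "Max ((\<lambda>k. real (m k 0) / real k) ` {1..n}) \<le> 2"
    and "\<forall>l\<in>{1..<N}. Max ((\<lambda>k. real (m k l) / real k) ` {1..n}) \<le> 1"
  shows "\<exists>C::real. C > 0 \<and>
    (\<forall>(a :: nat \<Rightarrow> (nat \<Rightarrow> nat) \<Rightarrow> complex \<Rightarrow> complex) (f :: complex \<Rightarrow> complex).
       (\<forall>k\<in>{1..n}. \<forall>j\<in>multi_indices m N k. a k j analytic_on ball 0 1) \<longrightarrow>
       meromorphic_solution n N m a f \<longrightarrow>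
       (\<forall>z\<in>ball 0 1.
          (\<Prod>l<N. spherical_deriv ((deriv ^^ l) f) z)
            \<le> C * (\<Sum>k=1..n. \<Sum>j\<in>multi_indices m N k. norm (a k j z) powr (1 / real k))))"
proof (intro exI[of _ 2] conjI allI impI ballI)
  fix a :: "nat \<Rightarrow> (nat \<Rightarrow> nat) \<Rightarrow> complex \<Rightarrow> complex" and f :: "complex \<Rightarrow> complex" and z :: complex
  assume a: "\<forall>k\<in>{1..n}. \<forall>j\<in>multi_indices m N k. a k j analytic_on ball 0 1"
    and sol: "meromorphic_solution n N m a f" and z: "z \<in> ball 0 1"
  have m0: "m k 0 \<le> 2 * k" if "k \<in> {1..n}" for k
  proof -
    have "real (m k 0) / real k \<le> 2"
      using that assms(3) by (intro order_trans[OF Max_ge assms(3)]) auto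
    thus ?thesis using that by (simp add: divide_le_eq)
  qed
  have m1: "m k l \<le> k" if "k \<in> {1..n}" "l \<in> {1..<N}" for k l
  proof -
    have "real (m k l) / real k \<le> 1"
      using that by (intro order_trans[OF Max_ge bspec[OF assms(4)]]) auto
    thus ?thesis using that by (simp add: divide_le_eq)
  qed
  have f: "f meromorphic_on {z}"
    using sol z unfolding meromorphic_solution_def by (auto intro: meromorphic_on_subset)
  \<comment> \<open>No distinction between regular and exceptional \<open>z\<close>: the inequality
    is shown on a punctured neighbourhood, and then \<open>w\<close> tends to
    \<open>z\<close>.\<close>
  show "(\<Prod>l<N. spherical_deriv ((deriv ^^ l) f) z)
          \<le> 2 * (\<Sum>k=1..n. \<Sum>j\<in>multi_indices m N k. norm (a k j z) powr (1 / real k))"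
  proof (rule tendsto_le[OF at_neq_bot])
    show "(\<lambda>w. \<Prod>l<N. norm ((deriv ^^ Suc l) f w) / (1 + (norm ((deriv ^^ l) f w))\<^sup>2))
            \<midarrow>z\<rightarrow> (\<Prod>l<N. spherical_deriv ((deriv ^^ l) f) z)"
      using tendsto_spherical_deriv[OF meromorphic_on_higher_deriv[OF f]]
      by (intro tendsto_prod) simp
    show "(\<lambda>w. 2 * (\<Sum>k=1..n. \<Sum>j\<in>multi_indices m N k. norm (a k j w) powr (1 / real k)))
            \<midarrow>z\<rightarrow> 2 * (\<Sum>k=1..n. \<Sum>j\<in>multi_indices m N k. norm (a k j z) powr (1 / real k))"
    proof (intro tendsto_mult tendsto_const tendsto_sum)
      fix k j assume k: "k \<in> {1..n}" and j: "j \<in> multi_indices m N k"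
      have "a k j analytic_on ball 0 1" using a k j by blast
      hence "a k j analytic_on {z}" by (rule analytic_on_subset) (use z in auto)
      hence "a k j \<midarrow>z\<rightarrow> a k j z" using analytic_at_imp_isCont isContD by blast
      \<comment> \<open>The coefficient may vanish at \<open>z\<close>; the power is continuous
        there because the exponent \<open>1 / real k\<close> is positive.\<close>
      thus "(\<lambda>w. norm (a k j w) powr (1 / real k)) \<midarrow>z\<rightarrow> norm (a k j z) powr (1 / real k)"
        using k by (intro tendsto_powr' tendsto_norm tendsto_const) auto
    qed
    have "eventually (\<lambda>w. (deriv ^^ N) f w ^ n
          + (\<Sum>k=1..n. diff_poly m a k N f w * (deriv ^^ N) f w ^ (n - k)) = 0) (at z)"
      using sol z unfolding meromorphic_solution_def
      by (intro eventually_cosparse_imp_eventually_at[of _ "ball 0 1" z UNIV]) auto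
    thus "eventually (\<lambda>w. (\<Prod>l<N. norm ((deriv ^^ Suc l) f w) / (1 + (norm ((deriv ^^ l) f w))\<^sup>2))
        \<le> 2 * (\<Sum>k=1..n. \<Sum>j\<in>multi_indices m N k. norm (a k j w) powr (1 / real k))) (at z)"
    proof eventually_elim
      case (elim w)
      show ?case
        using algebraic_estimate[of N n m "\<lambda>l. (deriv ^^ l) f w" "\<lambda>k j. a k j w"]
          assms(2) m0 m1 elim unfolding diff_poly_def by simp
    qed
  qed
qed simp

end
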